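(* Let $m\geq 3$ be an integer and let $D$ be a strongly connected digraph with minimum semi-degree $\delta(D)=\min\{\delta^+(D),\delta^-(D)\}\geq m+1$. Then $D$ contains a subdigraph $T$ isomorphic to the out-star $OS_m$ or to the in-star $IS_m$ such that $D-V(T)$ is strongly connected.
   Context: Digraphs are finite, without loops and without parallel arcs. A digraph is strongly connected if for every ordered pair of vertices $x,y$ there is a directed path from $x$ to $y$. $\delta^+(D)$ and $\delta^-(D)$ are the minimum out-degree and minimum in-degree of $D$. $D-V(T)$ is the subdigraph induced by $V(D)\setminus V(T)$. A star is a tree with exactly one vertex (the center) of degree greater than one (so a star of order $m$ requires $m\ge 3$). The out-star $OS_m$ is the digraph obtained from a star of order $m$ by orienting every edge away from the center, i.e. vertices $c,v_1,\dots,v_{m-1}$ and arcs $(c,v_i)$, $i=1,\dots,m-1$. The in-star $IS_m$ is obtained by orienting every edge towards the center, i.e. arcs $(v_i,c)$. *)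

theory Defs
  imports "Graph_Theory.Graph_Theory"
begin

definition min_out_degree :: "('a, 'b) pre_digraph \<Rightarrow> nat" where
  "min_out_degree D = Min (out_degree D ` verts D)"

definition min_in_degree :: "('a, 'b) pre_digraph \<Rightarrow> nat" where
  "min_in_degree D = Min (in_degree D ` verts D)"

definition min_semi_degree :: "('a, 'b) pre_digraph \<Rightarrow> nat" where
  "min_semi_degree D = min (min_out_degree D) (min_in_degree D)"

text \<open>The stars of order \<open>m\<close> on the vertex set \<open>{0,\<dots>,m-1}\<close>, with center \<open>0\<close> and leaves
  \<open>1,\<dots>,m-1\<close>.\<close>

definition out_star :: "nat \<Rightarrow> nat pair_pre_digraph" where
  "out_star m = \<lparr> pverts = {0..<m}, parcs = {(0, i) | i. i \<in> {1..<m}} \<rparr>"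

definition in_star :: "nat \<Rightarrow> nat pair_pre_digraph" where
  "in_star m = \<lparr> pverts = {0..<m}, parcs = {(i, 0) | i. i \<in> {1..<m}} \<rparr>"

end

theory Submission
  imports Defs
begin

text \<open>
  Among the vertex sets \<open>C\<close> that induce a strong subdigraph and leave a star of order \<open>m\<close> outside,
  take a maximal one; the claim is that nothing but the star is left. An ear of \<open>C\<close> is a walk outside
  \<open>C\<close> that starts at an out-neighbour and ends at an in-neighbour of \<open>C\<close>; adding an ear keeps \<open>C\<close>
  strong, so by maximality every ear meets every star outside \<open>C\<close>. Let \<open>p\<^sub>1, \<dots>, p\<^sub>k\<close> be a shortest
  ear. If \<open>k \<le> 2\<close>, a vertex outside \<open>C\<close> and off the ear that is not adjacent both to and from \<open>C\<close>
  would have at least \<open>m - 1\<close> out- or in-neighbours outside \<open>C\<close> and the ear; hence each such vertex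
  forms an ear by itself, \<open>k = 1\<close>, and so does every vertex outside \<open>C\<close>, in particular one off the
  given star. If \<open>k \<ge> 3\<close>, an out-neighbour \<open>v \<noteq> p\<^sub>2\<close> of \<open>p\<^sub>1\<close> sees at most \<open>p\<^sub>1\<close>, \<open>p\<^sub>2\<close>, \<open>p\<^sub>3\<close> on
  the ear and nothing in \<open>C\<close>, and so must see all three. Then any of these \<open>v\<close> may replace \<open>p\<^sub>2\<close>, so
  each of them sees all other out-neighbours of \<open>p\<^sub>1\<close>, of which there are at least \<open>m\<close>, and again
  there is a star off the ear.
\<close>

section \<open>Walks and strong sets of a relation\<close>

definition strong_on :: "'a rel \<Rightarrow> 'a set \<Rightarrow> bool" where
  "strong_on E S \<longleftrightarrow> S \<noteq> {} \<and> S \<times> S \<subseteq> rtrancl_on S E"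

definition walk :: "'a rel \<Rightarrow> 'a list \<Rightarrow> bool" where
  "walk E ps \<longleftrightarrow> ps \<noteq> [] \<and> successively (\<lambda>x y. (x, y) \<in> E) ps"

lemma walk_Nil [simp]: "\<not> walk E []"
  by (simp add: walk_def)

lemma walk_Cons [simp]: "walk E (x # ps) \<longleftrightarrow> ps = [] \<or> (x, hd ps) \<in> E \<and> walk E ps"
  by (auto simp: walk_def successively_Cons)

lemma walk_append:
  "xs \<noteq> [] \<Longrightarrow> ys \<noteq> [] \<Longrightarrow> walk E (xs @ ys) \<longleftrightarrow> walk E xs \<and> walk E ys \<and> (last xs, hd ys) \<in> E"
  by (auto simp: walk_def successively_append_iff)

lemma walk_drop: "walk E ps \<Longrightarrow> j < length ps \<Longrightarrow> walk E (drop j ps)"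
  by (metis append_take_drop_id drop_eq_Nil not_less successively_append_iff walk_def)

lemma walk_converse_rev: "walk (E\<inverse>) (rev ps) \<longleftrightarrow> walk E ps"
  by (simp add: walk_def)

lemma walk_reaches_member:
  assumes "walk E ps" "set ps \<subseteq> S" "x \<in> set ps"
  shows "(hd ps, x) \<in> rtrancl_on S E"
  using assms
  by (induction ps) (auto intro: converse_rtrancl_on_into_rtrancl_on)

lemma walk_member_reaches_last:
  assumes "walk E ps" "set ps \<subseteq> S" "x \<in> set ps"
  shows "(x, last ps) \<in> rtrancl_on S E"
  using walk_reaches_member[of "E\<inverse>" "rev ps" S x] assms
  by (simp add: walk_converse_rev hd_rev rtrancl_on_converseD)

lemma walk_subset_Domain: "walk E ps \<Longrightarrow> last ps \<in> Domain E \<Longrightarrow> set ps \<subseteq> Domain E"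
  by (induction ps) (auto split: if_splits)

lemma ex_walk_into:
  assumes "(x, c) \<in> rtrancl_on V E" "x \<notin> C" "c \<in> C"
  shows "\<exists>ps. walk E ps \<and> hd ps = x \<and> set ps \<inter> C = {} \<and> last ps \<in> E\<inverse> `` C"
  using assms
proof (induction rule: converse_rtrancl_on_induct)
  case (step x y)
  show ?case
  proof (cases "y \<in> C")
    case True
    with step show ?thesis by (intro exI[of _ "[x]"]) auto
  next
    case False
    with step obtain ps where "walk E ps" "hd ps = y" "set ps \<inter> C = {}" "last ps \<in> E\<inverse> `` C"
      by auto
    with step show ?thesis by (intro exI[of _ "x # ps"]) auto
  qed
qed simp

section \<open>Ears\<close>

definition ear :: "'a rel \<Rightarrow> 'a set \<Rightarrow> 'a list \<Rightarrow> bool" where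
  "ear E C ps \<longleftrightarrow> walk E ps \<and> set ps \<inter> C = {} \<and> hd ps \<in> E `` C \<and> last ps \<in> E\<inverse> `` C"

definition shortest_ear :: "'a rel \<Rightarrow> 'a set \<Rightarrow> 'a list \<Rightarrow> bool" where
  "shortest_ear E C ps \<longleftrightarrow> ear E C ps \<and> (\<forall>qs. ear E C qs \<longrightarrow> length ps \<le> length qs)"

lemma shortest_ear_imp_ear: "shortest_ear E C ps \<Longrightarrow> ear E C ps"
  by (simp add: shortest_ear_def)

lemma shortest_ear_minimal: "shortest_ear E C ps \<Longrightarrow> ear E C qs \<Longrightarrow> length ps \<le> length qs"
  by (simp add: shortest_ear_def)

lemma ear_singleton: "ear E C [v] \<longleftrightarrow> v \<notin> C \<and> v \<in> E `` C \<and> v \<in> E\<inverse> `` C"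
  by (auto simp: ear_def)

lemma ear_subset_Domain: "ear E C ps \<Longrightarrow> set ps \<subseteq> Domain E"
  by (intro walk_subset_Domain) (auto simp: ear_def)

lemma ear_append_drop:
  assumes "ear E C ps" "walk E xs" "set xs \<inter> C = {}" "hd xs \<in> E `` C"
    and "j < length ps" "(last xs, ps ! j) \<in> E"
  shows "ear E C (xs @ drop j ps)"
proof -
  have "xs \<noteq> []"
    using assms(2) by auto
  with assms show ?thesis
    by (auto simp: ear_def walk_append walk_drop hd_drop_conv_nth dest: in_set_dropD)
qed

lemma ex_shortest_ear:
  assumes "strong_on E V" "C \<subset> V" "C \<noteq> {}"
  shows "\<exists>ps. shortest_ear E C ps"
proof -
  obtain c x where in_C: "c \<in> C" "c \<in> V" and off_C: "x \<in> V" "x \<notin> C"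
    using assms by blast
  have reach: "(u, v) \<in> rtrancl_on V E" if "u \<in> V" "v \<in> V" for u v
    using assms(1) that by (auto simp: strong_on_def)
  have "\<exists>p \<in> V - C. p \<in> E `` C"
    using reach[OF in_C(2) off_C(1)] in_C(1) off_C(2)
    by (induction rule: converse_rtrancl_on_induct) auto
  then obtain p where entry: "p \<in> V" "p \<notin> C" "p \<in> E `` C" by blast
  have "\<exists>ps. ear E C ps"
    using ex_walk_into[OF reach[OF entry(1) in_C(2)] entry(2) in_C(1)] entry(3)
    unfolding ear_def by blast
  then show ?thesis
    unfolding shortest_ear_def using ex_has_least_nat[of "ear E C" _ length] by blast
qed

lemma shortest_ear_successors:
  assumes ps: "shortest_ear E C ps"
    and xs: "walk E xs" "set xs \<inter> C = {}" "hd xs \<in> E `` C"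
  shows "E `` {last xs} \<inter> set ps \<subseteq> set (take (Suc (length xs)) ps)"
proof
  fix y assume "y \<in> E `` {last xs} \<inter> set ps"
  then obtain j where arc: "j < length ps" "y = ps ! j" "(last xs, ps ! j) \<in> E"
    by (auto simp: in_set_conv_nth)
  then have "ear E C (xs @ drop j ps)"
    using shortest_ear_imp_ear[OF ps] xs by (intro ear_append_drop)
  then have "length ps \<le> length (xs @ drop j ps)"
    by (rule shortest_ear_minimal[OF ps])
  then have "j < Suc (length xs)"
    using arc(1) by simp
  with arc show "y \<in> set (take (Suc (length xs)) ps)"
    by (auto simp: in_set_conv_nth intro!: exI[of _ j])
qed

lemma strong_on_union_ear:
  assumes C: "strong_on E C" and ps: "ear E C ps"
  shows "strong_on E (C \<union> set ps)"
proof -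
  let ?S = "C \<union> set ps"
  have in_C: "(u, v) \<in> rtrancl_on ?S E" if "u \<in> C" "v \<in> C" for u v
    using C that rtrancl_on_mono[of E E C ?S u v] by (auto simp: strong_on_def)
  obtain a b where attach: "a \<in> C" "(a, hd ps) \<in> E" "b \<in> C" "(last ps, b) \<in> E"
    using ps by (auto simp: ear_def)
  have ps_walk: "walk E ps"
    using ps by (simp add: ear_def)
  have "(a, x) \<in> rtrancl_on ?S E \<and> (x, b) \<in> rtrancl_on ?S E" if "x \<in> ?S" for x
  proof (cases "x \<in> C")
    case True
    then show ?thesis using in_C attach by blast
  next
    case False
    with that have "x \<in> set ps" by simp
    then show ?thesis
      using walk_reaches_member[OF ps_walk, of ?S x] walk_member_reaches_last[OF ps_walk, of ?S x]
        attach
      by (auto intro: converse_rtrancl_on_into_rtrancl_on rtrancl_on_into_rtrancl_on)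
  qed
  then have "(x, y) \<in> rtrancl_on ?S E" if "x \<in> ?S" "y \<in> ?S" for x y
    using that in_C[OF attach(3,1)] by (meson rtrancl_on_trans)
  then show ?thesis
    using C by (auto simp: strong_on_def)
qed

section \<open>Stars\<close>

definition spans_star :: "'a rel \<Rightarrow> nat \<Rightarrow> 'a set \<Rightarrow> bool" where
  "spans_star E m T \<longleftrightarrow> finite T \<and> card T = m
    \<and> (\<exists>c\<in>T. T - {c} \<subseteq> E `` {c} \<or> T - {c} \<subseteq> E\<inverse> `` {c})"

definition has_star :: "'a rel \<Rightarrow> nat \<Rightarrow> 'a set \<Rightarrow> bool" where
  "has_star E m S \<longleftrightarrow> (\<exists>T\<subseteq>S. spans_star E m T)"

lemma has_star_converse: "has_star (E\<inverse>) m S \<longleftrightarrow> has_star E m S"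
  unfolding has_star_def spans_star_def by auto

lemma has_star_if_out_neighbours:
  assumes "c \<in> S" "L \<subseteq> E `` {c} \<inter> S" "c \<notin> L" "0 < m" "m \<le> Suc (card L)"
  shows "has_star E m S"
proof -
  have "m - 1 \<le> card L"
    using assms(5) by simp
  then obtain K where leaves: "K \<subseteq> L" "card K = m - 1" "finite K"
    by (rule obtain_subset_with_card_n)
  with assms have "spans_star E m (insert c K)"
    unfolding spans_star_def by (auto simp: card_insert_if)
  with leaves assms show ?thesis
    unfolding has_star_def by (intro exI[of _ "insert c K"]) auto
qed

section \<open>Relations of large minimum semi-degree\<close>

locale large_semi_degree =
  fixes V :: "'a set" and E :: "'a rel" and m :: nat
  assumes finite_V: "finite V" and E_subset: "E \<subseteq> V \<times> V" and irrefl: "(x, x) \<notin> E"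
    and m_pos: "0 < m"
    and out_card: "v \<in> V \<Longrightarrow> m + 1 \<le> card (E `` {v})"
    and in_card: "v \<in> V \<Longrightarrow> m + 1 \<le> card (E\<inverse> `` {v})"
begin

lemma large_semi_degree_converse: "large_semi_degree V (E\<inverse>) m"
  using finite_V E_subset irrefl m_pos out_card in_card by unfold_locales auto

lemma has_star_off_by_out:
  assumes "v \<in> V - C - P" "v \<notin> E\<inverse> `` C" "card (E `` {v} \<inter> P) \<le> 2"
  shows "has_star E m (V - C - P)"
proof (rule has_star_if_out_neighbours)
  have "E `` {v} \<subseteq> V"
    using E_subset by blast
  then have "finite (E `` {v})"
    using finite_V by (rule finite_subset)
  then have "card (E `` {v} - P) = card (E `` {v}) - card (E `` {v} \<inter> P)"
    by (intro card_Diff_subset_Int) simp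
  then show "m \<le> Suc (card (E `` {v} - P))"
    using out_card[of v] assms(1,3) by simp
qed (use assms E_subset irrefl m_pos in auto)

lemma has_star_off_by_in:
  assumes "v \<in> V - C - P" "v \<notin> E `` C" "card (E\<inverse> `` {v} \<inter> P) \<le> 2"
  shows "has_star E m (V - C - P)"
  using large_semi_degree.has_star_off_by_out[OF large_semi_degree_converse, of v C P] assms
  by (simp add: has_star_converse)

lemma has_star_off_vertex:
  assumes "v \<in> V"
  shows "has_star E m (V - {v})"
proof -
  have "E `` {v} \<noteq> {}"
    using out_card[OF assms] by (intro notI) simp
  then obtain w where arc: "(v, w) \<in> E" by blast
  have "card (E `` {w} \<inter> {v}) \<le> card {v}"
    by (intro card_mono) auto
  then show ?thesis
    using has_star_off_by_out[of w "{}" "{v}"] arc E_subset irrefl by auto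
qed

end

locale star_meeting_ears = large_semi_degree +
  fixes C :: "'a set"
  assumes ear_meets_stars: "ear E C ps \<Longrightarrow> \<not> has_star E m (V - C - set ps)"
begin

lemma ear_singleton_if_off_short_ear:
  assumes "ear E C ps" "length ps \<le> 2" "v \<in> V - C - set ps"
  shows "ear E C [v]"
proof -
  have "card (S \<inter> set ps) \<le> 2" for S
    using card_mono[of "set ps" "S \<inter> set ps"] card_length[of ps] assms(2) by simp
  then show ?thesis
    using ear_meets_stars[OF assms(1)] has_star_off_by_out[OF assms(3)]
      has_star_off_by_in[OF assms(3)] assms(3)
    unfolding ear_singleton by blast
qed

lemma ear_singleton_if_short_shortest_ear:
  assumes ps: "shortest_ear E C ps" "length ps \<le> 2" and "3 \<le> card (V - C)" and v: "v \<in> V - C"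
  shows "ear E C [v]"
proof -
  have ear: "ear E C ps"
    using ps(1) by (rule shortest_ear_imp_ear)
  have "card (set ps) < card (V - C)"
    using card_length[of ps] assms by linarith
  then obtain t where "t \<in> V - C - set ps"
    using card_mono[of "set ps" "V - C"] by auto
  then have "ear E C [t]"
    using ear ps(2) by (rule ear_singleton_if_off_short_ear[rotated 2])
  then have "length ps \<le> length [t]"
    by (rule shortest_ear_minimal[OF ps(1)])
  then obtain p where "ps = [p]"
    using ear by (cases ps) (auto simp: ear_def)
  then show ?thesis
    using ear_singleton_if_off_short_ear[OF ear ps(2)] ear v by (cases "v = p") auto
qed

lemma first_successor_off:
  assumes ps: "shortest_ear E C (p # q # r # rs)" and arc: "(p, v) \<in> E"
  shows "v \<in> V - C" and "v \<notin> E\<inverse> `` C" and "v \<noteq> q \<Longrightarrow> v \<notin> set (p # q # r # rs)"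
proof -
  have first: "p \<notin> C" "p \<in> E `` C"
    using shortest_ear_imp_ear[OF ps] by (auto simp: ear_def)
  have no_short: "\<not> ear E C [p]" "\<not> ear E C [p, v]"
    using shortest_ear_minimal[OF ps] by fastforce+
  show "v \<in> V - C"
    using first arc no_short(1) E_subset by (auto simp: ear_singleton)
  then show "v \<notin> E\<inverse> `` C"
    using first arc no_short(2) by (auto simp: ear_def)
  show "v \<notin> set (p # q # r # rs)" if "v \<noteq> q"
    using shortest_ear_successors[OF ps, of "[p]"] first arc irrefl that by auto
qed

lemma first_successor_dominates:
  assumes ps: "shortest_ear E C (p # q # r # rs)" and arc: "(p, v) \<in> E" "v \<noteq> q"
  shows "(v, q) \<in> E" and "(v, r) \<in> E"
proof -
  let ?ps = "p # q # r # rs"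
  have ear: "ear E C ?ps"
    using ps by (rule shortest_ear_imp_ear)
  then have first: "p \<notin> C" "p \<in> E `` C"
    by (auto simp: ear_def)
  have seen: "E `` {v} \<inter> set ?ps \<subseteq> {p, q, r}"
    using shortest_ear_successors[OF ps, of "[p, v]"] first arc
      first_successor_off(1)[OF ps arc(1)]
    by auto
  have "\<not> E `` {v} \<inter> set ?ps \<subseteq> {p, x}" for x
  proof
    assume "E `` {v} \<inter> set ?ps \<subseteq> {p, x}"
    then have "card (E `` {v} \<inter> set ?ps) \<le> card {p, x}"
      by (intro card_mono) auto
    also have "\<dots> \<le> 2"
      by (simp add: card_insert_if)
    finally have "has_star E m (V - C - set ?ps)"
      using first_successor_off[OF ps arc(1)] arc(2) by (intro has_star_off_by_out) auto
    then show False
      using ear_meets_stars[OF ear] by blast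
  qed
  then show "(v, q) \<in> E" "(v, r) \<in> E"
    using seen by blast+
qed

lemma shortest_ear_replace_second:
  assumes ps: "shortest_ear E C (p # q # r # rs)" and arc: "(p, w) \<in> E" "w \<noteq> q"
  shows "shortest_ear E C (p # w # r # rs)"
proof -
  have "ear E C ([p, w] @ drop 2 (p # q # r # rs))"
    using arc first_successor_off(1)[OF ps arc(1)] first_successor_dominates(2)[OF ps arc]
      shortest_ear_imp_ear[OF ps]
    by (intro ear_append_drop) (auto simp: ear_def)
  then show ?thesis
    using ps by (simp add: shortest_ear_def)
qed

lemma shortest_ear_length_le_2:
  assumes ps: "shortest_ear E C ps"
  shows "length ps \<le> 2"
proof (rule ccontr)
  assume "\<not> length ps \<le> 2"
  then obtain p q r rs where "ps = p # q # r # rs"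
    by (auto simp: not_less_eq_eq numeral_2_eq_2 Suc_le_length_iff)
  then have long: "shortest_ear E C (p # q # r # rs)"
    using ps by simp
  have ear: "ear E C (p # q # r # rs)"
    using long by (rule shortest_ear_imp_ear)
  let ?L = "E `` {p}"
  have "(p, q) \<in> E"
    using ear by (simp add: ear_def)
  then have degree: "m + 1 \<le> card ?L"
    using out_card E_subset by blast
  then have "\<not> ?L \<subseteq> {q}"
    using card_mono[of "{q}" ?L] m_pos by auto
  then obtain v where arc: "(p, v) \<in> E" "v \<noteq> q" by blast
  have "has_star E m (V - C - set (p # q # r # rs))"
  proof (rule has_star_if_out_neighbours)
    have "(v, w) \<in> E" if "(p, w) \<in> E" "w \<noteq> v" "w \<noteq> q" for w
      using first_successor_dominates(1)[OF shortest_ear_replace_second[OF long], of w v]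
        arc that by blast
    then show "?L - {v, q} \<subseteq> E `` {v} \<inter> (V - C - set (p # q # r # rs))"
      using first_successor_off[OF long] by blast
    have "card ?L - card {v, q} \<le> card (?L - {v, q})"
      by (intro diff_card_le_card_Diff) simp
    then show "m \<le> Suc (card (?L - {v, q}))"
      using degree arc(2) by simp
  qed (use arc first_successor_off[OF long] m_pos in auto)
  then show False
    using ear_meets_stars[OF ear] by blast
qed

end

context large_semi_degree
begin

lemma ex_ear_avoiding_star:
  assumes strong: "strong_on E V" and C: "C \<subseteq> V" "C \<noteq> {}"
    and T: "spans_star E m T" "T \<subset> V - C" and m_ge: "3 \<le> m"
  shows "\<exists>ps. ear E C ps \<and> has_star E m (V - C - set ps)"
proof (rule ccontr)
  assume "\<not> ?thesis"
  then interpret star_meeting_ears V E m C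
    by unfold_locales blast
  obtain r where off_T: "r \<in> V - C" "r \<notin> T"
    using T(2) by blast
  obtain ps where ps: "shortest_ear E C ps"
    using ex_shortest_ear[OF strong] C off_T by blast
  have "card T \<le> card (V - C)"
    using T(2) finite_V by (intro card_mono) auto
  then have "3 \<le> card (V - C)"
    using T(1) m_ge by (simp add: spans_star_def)
  then have "ear E C [r]"
    using ear_singleton_if_short_shortest_ear[OF ps shortest_ear_length_le_2[OF ps]] off_T(1)
    by blast
  moreover have "has_star E m (V - C - set [r])"
    using T off_T by (auto simp: has_star_def)
  ultimately show False
    using ear_meets_stars by blast
qed

theorem ex_star_strong_complement:
  assumes strong: "strong_on E V" and m_ge: "3 \<le> m"
  shows "\<exists>T\<subseteq>V. spans_star E m T \<and> strong_on E (V - T)"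
proof -
  let ?\<C> = "{C. C \<subseteq> V \<and> strong_on E C \<and> has_star E m (V - C)}"
  obtain v where "v \<in> V"
    using strong by (auto simp: strong_on_def)
  then have "{v} \<in> ?\<C>"
    by (simp add: has_star_off_vertex strong_on_def)
  moreover have "finite ?\<C>"
    using finite_V by simp
  ultimately obtain C where C: "C \<in> ?\<C>" and maximal: "\<And>C'. C' \<in> ?\<C> \<Longrightarrow> C \<subseteq> C' \<Longrightarrow> C = C'"
    using finite_has_maximal[of ?\<C>] by auto
  then obtain T where T: "T \<subseteq> V - C" "spans_star E m T"
    by (auto simp: has_star_def)
  have "T = V - C"
  proof (rule ccontr)
    assume "T \<noteq> V - C"
    then obtain ps where ps: "ear E C ps" "has_star E m (V - C - set ps)"
      using ex_ear_avoiding_star[OF strong, of C T] C T m_ge by (auto simp: strong_on_def)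
    have "set ps \<subseteq> V"
      using ear_subset_Domain[OF ps(1)] E_subset by blast
    moreover have "V - (C \<union> set ps) = V - C - set ps"
      by blast
    ultimately have "C \<union> set ps \<in> ?\<C>"
      using C ps(2) strong_on_union_ear[OF _ ps(1)] by simp
    then have "C = C \<union> set ps"
      by (rule maximal) simp
    then have "set ps \<subseteq> C" by blast
    moreover have "set ps \<noteq> {}" "set ps \<inter> C = {}"
      using ps(1) by (auto simp: ear_def)
    ultimately show False by (simp add: Int_absorb2)
  qed
  then have "V - T = C"
    using C by blast
  then show ?thesis
    using C T by (intro exI[of _ T]) auto
qed

end

section \<open>Digraphs and their arc relations\<close>

lemma strongly_connected_iff_strong_on:
  "strongly_connected D \<longleftrightarrow> strong_on (arcs_ends D) (verts D)"
  by (auto simp: strongly_connected_def strong_on_def reachable_def)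

lemma strong_on_Restr: "strong_on (Restr E S) S \<longleftrightarrow> strong_on E S"
proof -
  have "(u, v) \<in> rtrancl_on S (Restr E S)" if "(u, v) \<in> rtrancl_on S E" for u v
    using that by induction (auto intro: converse_rtrancl_on_into_rtrancl_on)
  moreover have "rtrancl_on S (Restr E S) \<subseteq> rtrancl_on S E"
    using rtrancl_on_mono[of "Restr E S" E S S] by auto
  ultimately show ?thesis
    unfolding strong_on_def by (auto 0 4)
qed

lemma strongly_connected_induce_iff:
  "strongly_connected (D \<restriction> S) \<longleftrightarrow> strong_on (arcs_ends D) S"
proof -
  have "arcs_ends (D \<restriction> S) = Restr (arcs_ends D) S"
    by (auto simp: arcs_ends_conv)
  then show ?thesis
    by (simp add: strongly_connected_iff_strong_on strong_on_Restr)
qed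

lemma (in nomulti_digraph) out_degree_eq_card_Image:
  "out_degree G v = card (arcs_ends G `` {v})"
  unfolding out_degree_def
proof (rule bij_betw_same_card)
  show "bij_betw (head G) (out_arcs G v) (arcs_ends G `` {v})"
    using no_multi_arcs
    by (force simp: bij_betw_def inj_on_def arc_to_ends_def arcs_ends_conv)
qed

lemma (in nomulti_digraph) in_degree_eq_card_Image:
  "in_degree G v = card ((arcs_ends G)\<inverse> `` {v})"
  unfolding in_degree_def
proof (rule bij_betw_same_card)
  show "bij_betw (tail G) (in_arcs G v) ((arcs_ends G)\<inverse> `` {v})"
    using no_multi_arcs
    by (force simp: bij_betw_def inj_on_def arc_to_ends_def arcs_ends_conv)
qed

lemma (in fin_digraph) min_semi_degree_le_degree:
  assumes "v \<in> verts G"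
  shows "min_semi_degree G \<le> out_degree G v" "min_semi_degree G \<le> in_degree G v"
  using assms
  by (auto simp: min_semi_degree_def min_out_degree_def min_in_degree_def
      intro: min.coboundedI1 min.coboundedI2)

lemma (in digraph) large_semi_degree_arcs_ends:
  assumes "0 < m" "m + 1 \<le> min_semi_degree G"
  shows "large_semi_degree (verts G) (arcs_ends G) m"
proof
  fix v assume "v \<in> verts G"
  from min_semi_degree_le_degree[OF this] assms(2)
  show "m + 1 \<le> card (arcs_ends G `` {v})" "m + 1 \<le> card ((arcs_ends G)\<inverse> `` {v})"
    by (simp_all add: out_degree_eq_card_Image in_degree_eq_card_Image)
qed (use assms(1) no_loops in \<open>auto simp: arcs_ends_conv\<close>)

lemma (in wf_digraph) ex_subgraph_iso_with_proj:
  assumes H: "pair_wf_digraph H" and inj: "inj_on f (pverts H)"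
    and verts: "f ` pverts H \<subseteq> verts G" and arcs: "map_prod f f ` parcs H \<subseteq> arcs_ends G"
  shows "\<exists>T. subgraph T G \<and> verts T = f ` pverts H \<and> digraph_iso T (with_proj H)"
proof -
  interpret H: pair_wf_digraph H by (fact H)
  have "\<forall>e\<in>parcs H. \<exists>a\<in>arcs G. arc_to_ends G a = map_prod f f e"
    using arcs unfolding arcs_ends_def image_subset_iff by (metis imageE)
  then obtain g where choice: "\<And>e. e \<in> parcs H \<Longrightarrow> g e \<in> arcs G"
      "\<And>e. e \<in> parcs H \<Longrightarrow> arc_to_ends G (g e) = map_prod f f e"
    by metis
  then have ends: "tail G (g e) = f (fst e)" "head G (g e) = f (snd e)" if "e \<in> parcs H" for e
    using that by (auto simp: arc_to_ends_def prod_eq_iff)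
  let ?h = "\<lparr>iso_verts = f, iso_arcs = g, iso_head = head G, iso_tail = tail G\<rparr>"
  let ?T = "app_iso ?h (with_proj H)"
  have "parcs H \<subseteq> pverts H \<times> pverts H"
    using H.arc_fst_in_verts H.arc_snd_in_verts by (intro subsetI) (simp add: mem_Times_iff)
  with map_prod_inj_on[OF inj inj] have "inj_on (map_prod f f) (parcs H)"
    by (rule inj_on_subset)
  then have "inj_on (arc_to_ends G \<circ> g) (parcs H)"
    using choice(2) by (simp cong: inj_on_cong)
  then have "inj_on g (parcs H)"
    by (rule inj_on_imageI2)
  then have iso: "pre_digraph.digraph_isomorphism (with_proj H) ?h"
    using inj ends H.wf_digraph by (simp add: pre_digraph.digraph_isomorphism_def)
  then have "digraph_iso (with_proj H) ?T"
    unfolding digraph_iso_def by (intro exI[of _ ?h]) simp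
  with H.wf_digraph have "digraph_iso ?T (with_proj H)"
    by (rule digraph_iso_swap)
  moreover have "wf_digraph ?T"
    using H.wf_digraph iso by (rule wf_digraph.wf_digraphI_app_iso)
  then have "subgraph ?T G"
    using verts choice(1) wf_digraph by (simp add: subgraph_def compatible_def image_subset_iff)
  ultimately show ?thesis
    by (intro exI[of _ ?T]) simp
qed

lemma ex_bij_betw_nat_finite_at_0:
  assumes "finite T" "c \<in> T"
  shows "\<exists>f. bij_betw f {0..<card T} T \<and> f 0 = c"
proof -
  obtain h where bij: "bij_betw h {0..<card T} T"
    using ex_bij_betw_nat_finite[OF assms(1)] by blast
  then obtain k where index: "k < card T" "h k = c"
    using assms(2) by (metis atLeastLessThan_iff bij_betw_imp_surj_on imageE)
  then have "bij_betw (transpose 0 k) {0..<card T} {0..<card T}"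
    by simp
  then have "bij_betw (h \<circ> transpose 0 k) {0..<card T} T"
    using bij by (rule bij_betw_trans)
  with index show ?thesis
    by (intro exI[of _ "h \<circ> transpose 0 k"]) simp
qed

lemma (in wf_digraph) ex_star_subgraph_if_spans_star:
  assumes T: "T \<subseteq> verts G" "spans_star (arcs_ends G) m T"
  shows "\<exists>S. subgraph S G \<and> verts S = T
    \<and> (digraph_iso S (with_proj (out_star m)) \<or> digraph_iso S (with_proj (in_star m)))"
proof -
  obtain c where center: "finite T" "card T = m" "c \<in> T"
    "T - {c} \<subseteq> arcs_ends G `` {c} \<or> T - {c} \<subseteq> (arcs_ends G)\<inverse> `` {c}"
    using T(2) by (auto simp: spans_star_def)
  obtain f where label: "bij_betw f {0..<m} T" "f 0 = c"
    using ex_bij_betw_nat_finite_at_0[OF center(1,3)] center(2) by blast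
  have inj: "inj_on f {0..<m}" and image: "f ` {0..<m} = T"
    using label(1) by (auto simp: bij_betw_def)
  have leaf: "f i \<in> T - {c}" if "i \<in> {1..<m}" for i
    using that inj image label(2) by (auto dest: inj_onD[of f _ i 0])
  have m_pos: "0 < m"
    using center by (auto simp: card_gt_0_iff)
  have stars_wf: "pair_wf_digraph (out_star m)" "pair_wf_digraph (in_star m)"
    using m_pos by unfold_locales (auto simp: out_star_def in_star_def)
  from center(4) show ?thesis
  proof
    assume "T - {c} \<subseteq> arcs_ends G `` {c}"
    then have "map_prod f f ` parcs (out_star m) \<subseteq> arcs_ends G"
      using leaf label(2) by (force simp: out_star_def)
    then show ?thesis
      using ex_subgraph_iso_with_proj[OF stars_wf(1), of f] inj image T(1)
      by (auto simp: out_star_def)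
  next
    assume "T - {c} \<subseteq> (arcs_ends G)\<inverse> `` {c}"
    then have "map_prod f f ` parcs (in_star m) \<subseteq> arcs_ends G"
      using leaf label(2) by (force simp: in_star_def)
    then show ?thesis
      using ex_subgraph_iso_with_proj[OF stars_wf(2), of f] inj image T(1)
      by (auto simp: in_star_def)
  qed
qed

theorem theorem4p2:
  fixes D :: "('a, 'b) pre_digraph" and m :: nat
  assumes "m \<ge> 3"
    and "digraph D"
    and "strongly_connected D"
    and "min_semi_degree D \<ge> m + 1"
  shows "\<exists>T. subgraph T D
    \<and> (digraph_iso T (with_proj (out_star m)) \<or> digraph_iso T (with_proj (in_star m)))
    \<and> strongly_connected (D \<restriction> (verts D - verts T))"
proof -
  interpret digraph D by fact
  interpret large_semi_degree "verts D" "arcs_ends D" m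
    using assms(1,4) by (intro large_semi_degree_arcs_ends) auto
  obtain S where "S \<subseteq> verts D" "spans_star (arcs_ends D) m S"
    and strong: "strong_on (arcs_ends D) (verts D - S)"
    using ex_star_strong_complement assms(1,3) strongly_connected_iff_strong_on by blast
  then obtain T where "subgraph T D" "verts T = S"
    "digraph_iso T (with_proj (out_star m)) \<or> digraph_iso T (with_proj (in_star m))"
    using ex_star_subgraph_if_spans_star by blast
  then show ?thesis
    using strong strongly_connected_induce_iff by blast
qed

end
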